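(* Let $A$ be a $\mathbb{C}[\partial]$-module with three $\mathbb{C}$-bilinear maps $\prec_\lambda,\succ_\lambda,\cdot_\lambda:A\otimes A\to A[\lambda]$ and commuting $\mathbb{C}$-linear maps $\alpha,\beta:A\to A$ that are multiplicative with respect to $\prec_\lambda,\succ_\lambda$ and $\cdot_\lambda$. Define $p*_\lambda q=p\prec_\lambda q+p\succ_\lambda q+p\cdot_\lambda q$ for all $p,q\in A$. Then $(A,\prec_\lambda,\succ_\lambda,\cdot_\lambda,\alpha,\beta)$ is a BiHom-tridendriform conformal algebra if and only if $(A,*_\lambda,\alpha,\beta)$ is a BiHom-associative conformal algebra and $A$, with multiplication $\circledcirc_\lambda=\cdot_\lambda$, left action $p\otimes m\mapsto p\succ_\lambda m$, right action $m\otimes p\mapsto m\prec_\lambda p$ and maps $\alpha,\beta$, is a conformal $(A,*_\lambda,\alpha,\beta)$-bimodule algebra.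
   Context: All vector spaces, linear maps and tensor products are over $\mathbb{C}$; $\lambda,\mu$ are formal variables. For a $\mathbb{C}[\partial]$-module $V$ put $V[\lambda]=\mathbb{C}[\lambda]\otimes V$. A $\mathbb{C}$-bilinear map $U\otimes V\to W[\lambda]$, $u\otimes v\mapsto u\circ_\lambda v$, is conformal sesquilinear if $(\partial u)\circ_\lambda v=-\lambda(u\circ_\lambda v)$ and $u\circ_\lambda(\partial v)=(\partial+\lambda)(u\circ_\lambda v)$. Linear maps and products are extended coefficientwise to polynomials in $\lambda,\mu$; e.g. if $u\circ_\lambda v=\sum_i\lambda^i a_i$ then $(u\circ_\lambda v)\circ_{\lambda+\mu}w=\sum_i\lambda^i(a_i\circ_{\lambda+\mu}w)$. A map $\alpha$ is multiplicative for $\circ_\lambda$ if $\alpha(p\circ_\lambda q)=\alpha(p)\circ_\lambda\alpha(q)$. A BiHom-associative conformal algebra $(A,\cdot_\lambda,\alpha,\beta)$, with product written $p_\lambda q$, is a $\mathbb{C}[\partial]$-module $A$ with a conformal sesquilinear map $A\otimes A\to A[\lambda]$, $p\otimes q\mapsto p_\lambda q$, and commuting $\mathbb{C}$-linear maps $\alpha,\beta:A\to A$ commuting with $\partial$ and multiplicative, such that $\alpha(p)_\lambda(q_\mu r)=(p_\lambda q)_{\lambda+\mu}\beta(r)$. A BiHom-tridendriform conformal algebra $(A,\prec_\lambda,\succ_\lambda,\cdot_\lambda,\alpha,\beta)$ is a $\mathbb{C}[\partial]$-module $A$ with three conformal sesquilinear maps $\prec_\lambda,\succ_\lambda,\cdot_\lambda:A\otimes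 A\to A[\lambda]$ and commuting $\mathbb{C}$-linear maps $\alpha,\beta:A\to A$ commuting with $\partial$ and multiplicative for all three products, such that for all $p,q,r\in A$: $(p\prec_\lambda q)\prec_{\lambda+\mu}\beta(r)=\alpha(p)\prec_\lambda(q\prec_\mu r+q\succ_\mu r+q\cdot_\mu r)$; $(p\succ_\lambda q)\prec_{\lambda+\mu}\beta(r)=\alpha(p)\succ_\lambda(q\prec_\mu r)$; $\alpha(p)\succ_\lambda(q\succ_\mu r)=(p\prec_\lambda q+p\succ_\lambda q+p\cdot_\lambda q)\succ_{\lambda+\mu}\beta(r)$; $\alpha(p)\cdot_\lambda(q\succ_\mu r)=(p\prec_\lambda q)\cdot_{\lambda+\mu}\beta(r)$; $\alpha(p)\succ_\lambda(q\cdot_\mu r)=(p\succ_\lambda q)\cdot_{\lambda+\mu}\beta(r)$; $\alpha(p)\cdot_\lambda(q\prec_\mu r)=(p\cdot_\lambda q)\prec_{\lambda+\mu}\beta(r)$; $\alpha(p)\cdot_\lambda(q\cdot_\mu r)=(p\cdot_\lambda q)\cdot_{\lambda+\mu}\beta(r)$. Let $(A,\cdot_\lambda,\alpha_A,\beta_A)$ be a BiHom-associative conformal algebra, $M$ a $\mathbb{C}[\partial]$-module, $\alpha_M,\beta_M:M\to M$ commuting $\mathbb{C}$-linear maps, and let $l_\lambda:A\otimes M\to M[\lambda]$, $p\otimes m\mapsto p_\lambda m$, $r_\lambda:M\otimes A\to M[\lambda]$, $m\otimes p\mapsto m_\lambda p$, and $\circledcirc_\lambda:M\otimes M\to M[\lambda]$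 be $\mathbb{C}$-bilinear. Then $(M,\circledcirc_\lambda,l_\lambda,r_\lambda,\alpha_M,\beta_M)$ is a conformal $A$-bimodule algebra if $A\oplus M$ (with $\partial(p,m)=(\partial p,\partial m)$) is a BiHom-associative conformal algebra under $(p,m)_\lambda(p',m')=(p_\lambda p',\;p_\lambda m'+m_\lambda p'+m\circledcirc_\lambda m')$ with structure maps $\alpha(p,m)=(\alpha_A(p),\alpha_M(m))$, $\beta(p,m)=(\beta_A(p),\beta_M(m))$. *)

theory Defs
  imports "HOL-Computational_Algebra.Polynomial" "HOL-Analysis.Product_Vector"
begin

text \<open>
  A module over the polynomial ring in the derivation is a structure
  \<open>module s\<close> with \<open>s :: complex poly \<Rightarrow> 'a \<Rightarrow> 'a\<close>;
  the carrier is the whole type. The space of polynomials in a formal variable with coefficients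
  in \<open>'a\<close> is \<open>'a poly\<close>. Polynomials in \<open>\<lambda>\<close> and
  \<open>\<mu>\<close> are elements of \<open>'a poly poly\<close>: the outer variable is
  \<open>\<lambda>\<close>, the inner one (in the coefficients) is \<open>\<mu>\<close>.
\<close>

type_synonym ('a, 'b, 'c) lambda_product = "'a \<Rightarrow> 'b \<Rightarrow> 'c poly"

definition cscale :: "(complex poly \<Rightarrow> 'a \<Rightarrow> 'a) \<Rightarrow> complex \<Rightarrow> 'a \<Rightarrow> 'a" where
  "cscale s c = s [:c:]"

definition deriv_act :: "(complex poly \<Rightarrow> 'a \<Rightarrow> 'a) \<Rightarrow> 'a \<Rightarrow> 'a" where
  "deriv_act s = s [:0, 1:]"

definition poly_cscale ::
  "(complex poly \<Rightarrow> 'a \<Rightarrow> 'a) \<Rightarrow> complex \<Rightarrow> 'a::ab_group_add poly \<Rightarrow> 'a poly" where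
  "poly_cscale s c = map_poly (cscale s c)"

definition clinear_endo ::
  "(complex poly \<Rightarrow> 'a \<Rightarrow> 'a) \<Rightarrow> ('a::ab_group_add \<Rightarrow> 'a) \<Rightarrow> bool" where
  "clinear_endo s f \<longleftrightarrow> Vector_Spaces.linear (cscale s) (cscale s) f"

definition lambda_bilinear ::
  "(complex poly \<Rightarrow> 'a \<Rightarrow> 'a) \<Rightarrow> (complex poly \<Rightarrow> 'b \<Rightarrow> 'b) \<Rightarrow> (complex poly \<Rightarrow> 'c \<Rightarrow> 'c)
    \<Rightarrow> ('a::ab_group_add, 'b::ab_group_add, 'c::ab_group_add) lambda_product \<Rightarrow> bool" where
  "lambda_bilinear s\<^sub>1 s\<^sub>2 s\<^sub>3 f \<longleftrightarrow>
     (\<forall>v. Vector_Spaces.linear (cscale s\<^sub>1) (poly_cscale s\<^sub>3) (\<lambda>u. f u v)) \<and>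
     (\<forall>u. Vector_Spaces.linear (cscale s\<^sub>2) (poly_cscale s\<^sub>3) (\<lambda>v. f u v))"

text \<open>Multiplication by the formal variable is \<open>pCons 0\<close>.\<close>

definition conformal_sesquilinear ::
  "(complex poly \<Rightarrow> 'a \<Rightarrow> 'a) \<Rightarrow> (complex poly \<Rightarrow> 'b \<Rightarrow> 'b) \<Rightarrow> (complex poly \<Rightarrow> 'c \<Rightarrow> 'c)
    \<Rightarrow> ('a::ab_group_add, 'b::ab_group_add, 'c::ab_group_add) lambda_product \<Rightarrow> bool" where
  "conformal_sesquilinear s\<^sub>1 s\<^sub>2 s\<^sub>3 f \<longleftrightarrow>
     lambda_bilinear s\<^sub>1 s\<^sub>2 s\<^sub>3 f \<and>
     (\<forall>u v. f (deriv_act s\<^sub>1 u) v = - pCons 0 (f u v)) \<and>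
     (\<forall>u v. f u (deriv_act s\<^sub>2 v) = map_poly (deriv_act s\<^sub>3) (f u v) + pCons 0 (f u v))"

definition multiplicative :: "('a::zero \<Rightarrow> 'a) \<Rightarrow> ('a, 'a, 'a) lambda_product \<Rightarrow> bool" where
  "multiplicative \<alpha> f \<longleftrightarrow> (\<forall>p q. map_poly \<alpha> (f p q) = f (\<alpha> p) (\<alpha> q))"

text \<open>
  Substitution of \<open>\<lambda> + \<mu>\<close> for the variable: the summand for \<open>n\<close> and
  \<open>k\<close> is \<open>(n choose k) \<lambda>^k \<mu>^(n - k) a\<^sub>n\<close>.
\<close>

definition subst_add ::
  "(complex poly \<Rightarrow> 'a \<Rightarrow> 'a) \<Rightarrow> 'a::ab_group_add poly \<Rightarrow> 'a poly poly" where
  "subst_add s P =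
     (\<Sum>n\<le>degree P. \<Sum>k\<le>n.
        monom (monom (cscale s (of_nat (n choose k)) (coeff P n)) (n - k)) k)"

text \<open>\<open>nest_right f g x y z\<close> is the element
  \<open>x f\<^sub>\<lambda> (y g\<^sub>\<mu> z) = (\<Sum>j. \<mu>^j (x f\<^sub>\<lambda> b\<^sub>j))\<close>,
  where \<open>y g\<^sub>\<mu> z = (\<Sum>j. \<mu>^j b\<^sub>j)\<close>.\<close>

definition nest_right ::
  "('a, 'a, 'a) lambda_product \<Rightarrow> ('a, 'a, 'a) lambda_product \<Rightarrow> 'a \<Rightarrow> 'a \<Rightarrow> 'a
    \<Rightarrow> 'a::ab_group_add poly poly" where
  "nest_right f g x y z =
     (\<Sum>j\<le>degree (g y z). map_poly (\<lambda>c. monom c j) (f x (coeff (g y z) j)))"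

text \<open>\<open>nest_left s f g x y z\<close> is the element
  \<open>(x f\<^sub>\<lambda> y) g\<^sub>\<lambda>\<^sub>+\<^sub>\<mu> z = (\<Sum>i. \<lambda>^i (a\<^sub>i g\<^sub>\<lambda>\<^sub>+\<^sub>\<mu> z))\<close>,
  where \<open>x f\<^sub>\<lambda> y = (\<Sum>i. \<lambda>^i a\<^sub>i)\<close>.\<close>

definition nest_left ::
  "(complex poly \<Rightarrow> 'a \<Rightarrow> 'a) \<Rightarrow> ('a, 'a, 'a) lambda_product \<Rightarrow> ('a, 'a, 'a) lambda_product
    \<Rightarrow> 'a \<Rightarrow> 'a \<Rightarrow> 'a \<Rightarrow> 'a::ab_group_add poly poly" where
  "nest_left s f g x y z =
     (\<Sum>i\<le>degree (f x y). (pCons 0 ^^ i) (subst_add s (g (coeff (f x y) i) z)))"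

definition bihom_assoc_conformal_algebra ::
  "(complex poly \<Rightarrow> 'a \<Rightarrow> 'a) \<Rightarrow> ('a::ab_group_add, 'a, 'a) lambda_product
    \<Rightarrow> ('a \<Rightarrow> 'a) \<Rightarrow> ('a \<Rightarrow> 'a) \<Rightarrow> bool" where
  "bihom_assoc_conformal_algebra s f \<alpha> \<beta> \<longleftrightarrow>
     module s \<and>
     conformal_sesquilinear s s s f \<and>
     clinear_endo s \<alpha> \<and> clinear_endo s \<beta> \<and> \<alpha> \<circ> \<beta> = \<beta> \<circ> \<alpha> \<and>
     \<alpha> \<circ> deriv_act s = deriv_act s \<circ> \<alpha> \<and> \<beta> \<circ> deriv_act s = deriv_act s \<circ> \<beta> \<and>
     multiplicative \<alpha> f \<and> multiplicative \<beta> f \<and>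
     (\<forall>p q r. nest_right f f (\<alpha> p) q r = nest_left s f f p q (\<beta> r))"

definition total_product ::
  "('a, 'a, 'a) lambda_product \<Rightarrow> ('a, 'a, 'a) lambda_product \<Rightarrow> ('a, 'a, 'a) lambda_product
    \<Rightarrow> ('a, 'a, 'a::ab_group_add) lambda_product" where
  "total_product prec succ dot p q = prec p q + succ p q + dot p q"

definition bihom_tridendriform_conformal_algebra ::
  "(complex poly \<Rightarrow> 'a \<Rightarrow> 'a) \<Rightarrow> ('a::ab_group_add, 'a, 'a) lambda_product
    \<Rightarrow> ('a, 'a, 'a) lambda_product \<Rightarrow> ('a, 'a, 'a) lambda_product
    \<Rightarrow> ('a \<Rightarrow> 'a) \<Rightarrow> ('a \<Rightarrow> 'a) \<Rightarrow> bool" where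
  "bihom_tridendriform_conformal_algebra s prec succ dot \<alpha> \<beta> \<longleftrightarrow>
     module s \<and>
     conformal_sesquilinear s s s prec \<and>
     conformal_sesquilinear s s s succ \<and>
     conformal_sesquilinear s s s dot \<and>
     clinear_endo s \<alpha> \<and> clinear_endo s \<beta> \<and> \<alpha> \<circ> \<beta> = \<beta> \<circ> \<alpha> \<and>
     \<alpha> \<circ> deriv_act s = deriv_act s \<circ> \<alpha> \<and> \<beta> \<circ> deriv_act s = deriv_act s \<circ> \<beta> \<and>
     multiplicative \<alpha> prec \<and> multiplicative \<alpha> succ \<and> multiplicative \<alpha> dot \<and>
     multiplicative \<beta> prec \<and> multiplicative \<beta> succ \<and> multiplicative \<beta> dot \<and>
     (\<forall>p q r.
        nest_left s prec prec p q (\<beta> r) =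
          nest_right prec (total_product prec succ dot) (\<alpha> p) q r \<and>
        nest_left s succ prec p q (\<beta> r) = nest_right succ prec (\<alpha> p) q r \<and>
        nest_right succ succ (\<alpha> p) q r =
          nest_left s (total_product prec succ dot) succ p q (\<beta> r) \<and>
        nest_right dot succ (\<alpha> p) q r = nest_left s prec dot p q (\<beta> r) \<and>
        nest_right succ dot (\<alpha> p) q r = nest_left s succ dot p q (\<beta> r) \<and>
        nest_right dot prec (\<alpha> p) q r = nest_left s dot prec p q (\<beta> r) \<and>
        nest_right dot dot (\<alpha> p) q r = nest_left s dot dot p q (\<beta> r))"

text \<open>The identification of pairs of polynomials with polynomials that have pairs as
  coefficients.\<close>

definition poly_pair :: "'a::ab_group_add poly \<Rightarrow> 'b::ab_group_add poly \<Rightarrow> ('a \<times> 'b) poly" where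
  "poly_pair P Q = map_poly (\<lambda>a. (a, 0)) P + map_poly (\<lambda>m. (0, m)) Q"

definition semidirect_product ::
  "('a::ab_group_add, 'a, 'a) lambda_product \<Rightarrow> ('m::ab_group_add, 'm, 'm) lambda_product
    \<Rightarrow> ('a, 'm, 'm) lambda_product \<Rightarrow> ('m, 'a, 'm) lambda_product
    \<Rightarrow> ('a \<times> 'm, 'a \<times> 'm, 'a \<times> 'm) lambda_product" where
  "semidirect_product f g l r =
     (\<lambda>(p, m) (p', m'). poly_pair (f p p') (l p m' + r m p' + g m m'))"

definition conformal_bimodule_algebra ::
  "(complex poly \<Rightarrow> 'a \<Rightarrow> 'a) \<Rightarrow> ('a::ab_group_add, 'a, 'a) lambda_product
    \<Rightarrow> ('a \<Rightarrow> 'a) \<Rightarrow> ('a \<Rightarrow> 'a)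
    \<Rightarrow> (complex poly \<Rightarrow> 'm \<Rightarrow> 'm) \<Rightarrow> ('m::ab_group_add, 'm, 'm) lambda_product
    \<Rightarrow> ('a, 'm, 'm) lambda_product \<Rightarrow> ('m, 'a, 'm) lambda_product
    \<Rightarrow> ('m \<Rightarrow> 'm) \<Rightarrow> ('m \<Rightarrow> 'm) \<Rightarrow> bool" where
  "conformal_bimodule_algebra s f \<alpha> \<beta> t g l r \<alpha>\<^sub>M \<beta>\<^sub>M \<longleftrightarrow>
     bihom_assoc_conformal_algebra s f \<alpha> \<beta> \<and>
     module t \<and>
     clinear_endo t \<alpha>\<^sub>M \<and> clinear_endo t \<beta>\<^sub>M \<and> \<alpha>\<^sub>M \<circ> \<beta>\<^sub>M = \<beta>\<^sub>M \<circ> \<alpha>\<^sub>M \<and>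
     lambda_bilinear t t t g \<and> lambda_bilinear s t t l \<and> lambda_bilinear t s t r \<and>
     bihom_assoc_conformal_algebra (module_prod.scale s t) (semidirect_product f g l r)
       (map_prod \<alpha> \<alpha>\<^sub>M) (map_prod \<beta> \<beta>\<^sub>M)"

end

theory Submission
  imports Defs
begin

text \<open>
  Associativity in the semidirect product \<open>A \<oplus> A\<close> is an identity that is additive in each of
  its three arguments. It therefore holds iff it holds whenever each argument lies in one of the
  two summands. If all three lie in the algebra \<open>A\<close>, the identity is associativity of the total
  product \<open>*\<close>. In the other seven cases the value lies in the bimodule \<open>A\<close>, and since elements
  of the algebra act on it from the left by \<open>\<succ>\<close>, from the right by \<open>\<prec>\<close>, and its own
  product is the dot, these seven cases are the seven tridendriform axioms, one axiom each:
  for instance, algebra, algebra, bimodule gives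
  \<open>\<alpha>(p) \<succ> (q \<succ> m) = (p * q) \<succ> \<beta>(m)\<close>. This is
  \<open>semidirect_product_associative_iff\<close>. In the same way the semidirect product is conformal
  sesquilinear iff its four constituents are (\<open>conformal_sesquilinear_semidirect_product_iff\<close>).

  Hence the bimodule algebra condition says exactly that the tridendriform axioms hold and that
  \<open>*\<close> makes \<open>A\<close> a BiHom-associative conformal algebra. The latter follows from the
  tridendriform axioms: their sum is associativity of \<open>*\<close>, because nested products are
  additive in each of the two products involved.

  All identities between nested products are checked coefficientwise. The sums that define
  \<open>nest_left\<close>, \<open>nest_right\<close> and \<open>subst_add\<close> run up to the degrees of polynomials, and these
  are not additive; the coefficient formulas \<open>coeff_nest_left\<close> and \<open>coeff_nest_right\<close> do not
  mention degrees.
\<close>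

section \<open>The scalar action of the complex numbers\<close>

lemma module_vector_space_cscale:
  assumes "module s" shows "vector_space (cscale s)"
proof -
  interpret module s by fact
  show ?thesis
    unfolding cscale_def
  proof
    fix a b x
    show "s [:a + b:] x = s [:a:] x + s [:b:] x"
      using scale_left_distrib[of "[:a:]" "[:b:]" x] by simp
    show "s [:a:] (s [:b:] x) = s [:a * b:] x"
      by (simp add: ac_simps)
    show "s [:1:] x = x" using scale_one by (simp add: one_pCons)
  qed (simp add: scale_right_distrib)
qed

lemma cscale_0 [simp]: "module s \<Longrightarrow> cscale s c 0 = 0"
  by (simp add: cscale_def module.scale_zero_right)

lemma cscale_add: "module s \<Longrightarrow> cscale s c (x + y) = cscale s c x + cscale s c y"
  by (simp add: cscale_def module.scale_right_distrib)

lemma deriv_act_0 [simp]: "module s \<Longrightarrow> deriv_act s 0 = 0"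
  by (simp add: deriv_act_def module.scale_zero_right)

lemma deriv_act_add: "module s \<Longrightarrow> deriv_act s (x + y) = deriv_act s x + deriv_act s y"
  by (simp add: deriv_act_def module.scale_right_distrib)

lemma module_vector_space_poly_cscale:
  assumes "module s" shows "vector_space (poly_cscale s)"
proof -
  interpret vector_space "cscale s" using assms by (rule module_vector_space_cscale)
  show ?thesis
    by standard
      (auto simp: poly_eq_iff poly_cscale_def coeff_map_poly scale_right_distrib
        scale_left_distrib)
qed

section \<open>Bilinear and biadditive products\<close>

lemma lambda_bilinear_iff:
  assumes "module s\<^sub>1" "module s\<^sub>2" "module s\<^sub>3"
  shows "lambda_bilinear s\<^sub>1 s\<^sub>2 s\<^sub>3 f \<longleftrightarrow>
    (\<forall>u u' v. f (u + u') v = f u v + f u' v) \<and>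
    (\<forall>u v v'. f u (v + v') = f u v + f u v') \<and>
    (\<forall>c u v. f (cscale s\<^sub>1 c u) v = poly_cscale s\<^sub>3 c (f u v)) \<and>
    (\<forall>c u v. f u (cscale s\<^sub>2 c v) = poly_cscale s\<^sub>3 c (f u v))"
  using assms[THEN module_vector_space_cscale] module_vector_space_poly_cscale[OF assms(3)]
  unfolding lambda_bilinear_def Vector_Spaces.linear_iff by blast

text \<open>The part of bilinearity that the expansion of nested products uses. It does not mention the
  scalar actions, and so treats the three products, their sum and the semidirect product alike.\<close>

definition biadditive ::
  "('a::ab_group_add, 'b::ab_group_add, 'c::ab_group_add) lambda_product \<Rightarrow> bool" where
  "biadditive f \<longleftrightarrow>
     (\<forall>u u' v. f (u + u') v = f u v + f u' v) \<and>
     (\<forall>u v v'. f u (v + v') = f u v + f u v')"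

lemma biadditiveD:
  assumes "biadditive f"
  shows "f (u + u') v = f u v + f u' v" "f u (v + v') = f u v + f u v'" "f 0 v = 0" "f u 0 = 0"
proof -
  show add: "f (u + u') v = f u v + f u' v" "f u (v + v') = f u v + f u v'" for u u' v v'
    using assms by (auto simp: biadditive_def)
  show "f 0 v = 0" using add(1)[of 0 0 v] by simp
  show "f u 0 = 0" using add(2)[of u 0 0] by simp
qed

lemma lambda_bilinear_biadditive: "lambda_bilinear s\<^sub>1 s\<^sub>2 s\<^sub>3 f \<Longrightarrow> biadditive f"
  unfolding lambda_bilinear_def biadditive_def Vector_Spaces.linear_iff by blast

section \<open>Coefficients of nested products\<close>

text \<open>A monomial of degree \<open>n\<close> contributes to \<open>\<lambda>^k \<mu>^j\<close> only for \<open>n = k + j\<close>.\<close>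

lemma coeff_subst_add:
  assumes "module s"
  shows "coeff (coeff (subst_add s P) k) j = cscale s (of_nat ((k + j) choose k)) (coeff P (k + j))"
proof -
  have "coeff (coeff (subst_add s P) k) j =
      (\<Sum>n\<le>degree P. \<Sum>i\<le>n. if i = k \<and> n = k + j
         then cscale s (of_nat ((k + j) choose k)) (coeff P (k + j)) else 0)"
    unfolding subst_add_def coeff_sum by (intro sum.cong refl) auto
  also have "\<dots> = (\<Sum>n\<le>degree P. if n = k + j
         then cscale s (of_nat ((k + j) choose k)) (coeff P (k + j)) else 0)"
    by (intro sum.cong refl) (auto simp: sum.delta)
  also have "\<dots> = cscale s (of_nat ((k + j) choose k)) (coeff P (k + j))"
    using assms by (simp add: coeff_eq_0)
  finally show ?thesis .
qed

text \<open>For \<open>j\<close> above the degree of \<open>g y z\<close> the left side has no summand and the right side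
  is a coefficient of \<open>f x 0 = 0\<close>.\<close>

lemma coeff_nest_right:
  assumes "biadditive f"
  shows "coeff (coeff (nest_right f g x y z) k) j = coeff (f x (coeff (g y z) j)) k"
proof -
  have "coeff (coeff (nest_right f g x y z) k) j =
    (\<Sum>n\<le>degree (g y z). if n = j then coeff (f x (coeff (g y z) j)) k else 0)"
    unfolding nest_right_def coeff_sum by (intro sum.cong refl) (auto simp: coeff_map_poly)
  also have "\<dots> = coeff (f x (coeff (g y z) j)) k"
    by (simp add: coeff_eq_0 biadditiveD[OF assms])
  finally show ?thesis .
qed

lemma coeff_pCons_0_power: "coeff ((pCons 0 ^^ i) P) k = (if i \<le> k then coeff P (k - i) else 0)"
  by (induction i arbitrary: k) (auto simp: coeff_pCons split: nat.splits)

text \<open>The power \<open>\<lambda>^i\<close> of the inner product leaves \<open>\<lambda>^(k - i)\<close> to the expansion of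
  \<open>\<lambda> + \<mu>\<close>. The summation range depends only on \<open>k\<close>, so that the right side is
  additive in \<open>f\<close> as well as in \<open>g\<close>.\<close>

lemma coeff_nest_left:
  assumes "module s" "biadditive g"
  shows "coeff (coeff (nest_left s f g x y z) k) j =
    (\<Sum>i\<le>k. cscale s (of_nat ((k - i + j) choose (k - i))) (coeff (g (coeff (f x y) i) z) (k - i + j)))"
    (is "_ = sum ?t _")
proof -
  have t0: "?t i = 0" if "i > degree (f x y)" for i
    using that assms(1) by (simp add: coeff_eq_0 biadditiveD[OF assms(2)])
  have "coeff (coeff (nest_left s f g x y z) k) j = (\<Sum>i\<le>degree (f x y). if i \<le> k then ?t i else 0)"
    unfolding nest_left_def coeff_sum
    by (intro sum.cong refl) (auto simp: coeff_pCons_0_power coeff_subst_add assms)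
  also have "\<dots> = (\<Sum>i\<in>{..degree (f x y)} \<inter> {..k}. ?t i)"
    by (subst sum.inter_restrict) auto
  also have "\<dots> = sum ?t {..k}"
  proof (rule sum.mono_neutral_left)
    show "\<forall>i\<in>{..k} - {..degree (f x y)} \<inter> {..k}. ?t i = 0"
    proof
      fix i assume "i \<in> {..k} - {..degree (f x y)} \<inter> {..k}"
      then have "i > degree (f x y)" by auto
      then show "?t i = 0" by (rule t0)
    qed
  qed auto
  finally show ?thesis .
qed

text \<open>Expansion of nested products along the total product turns the sum of the seven
  tridendriform axioms into associativity of the total product.\<close>

lemma biadditive_total_product:
  assumes "biadditive prec" "biadditive succ" "biadditive dot"
  shows "biadditive (total_product prec succ dot)"
  using assms by (simp add: biadditive_def total_product_def add_ac)

lemma nest_right_total_product_inner: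
  assumes "biadditive f"
  shows "nest_right f (total_product prec succ dot) x y z =
    nest_right f prec x y z + nest_right f succ x y z + nest_right f dot x y z"
  by (simp add: poly_eq_iff coeff_nest_right assms total_product_def biadditiveD[OF assms])

lemma nest_right_total_product_outer:
  assumes "biadditive prec" "biadditive succ" "biadditive dot"
  shows "nest_right (total_product prec succ dot) g x y z =
    nest_right prec g x y z + nest_right succ g x y z + nest_right dot g x y z"
  by (simp add: poly_eq_iff coeff_nest_right assms biadditive_total_product)
     (simp add: total_product_def)

lemma nest_left_total_product_inner:
  assumes "module s" "biadditive g"
  shows "nest_left s (total_product prec succ dot) g x y z =
    nest_left s prec g x y z + nest_left s succ g x y z + nest_left s dot g x y z"
  by (simp add: poly_eq_iff coeff_nest_left assms total_product_def biadditiveD[OF assms(2)]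
      cscale_add[OF assms(1)] sum.distrib)

lemma nest_left_total_product_outer:
  assumes "module s" "biadditive prec" "biadditive succ" "biadditive dot"
  shows "nest_left s f (total_product prec succ dot) x y z =
    nest_left s f prec x y z + nest_left s f succ x y z + nest_left s f dot x y z"
  by (simp add: poly_eq_iff coeff_nest_left assms biadditive_total_product)
     (simp add: total_product_def cscale_add[OF assms(1)] sum.distrib)

section \<open>Direct sums\<close>

text \<open>The next lemmas say that \<open>poly_pair\<close> is an injective homomorphism for the operations that
  occur in sesquilinearity and multiplicativity, so that these conditions split into
  components.\<close>

lemma coeff_poly_pair: "coeff (poly_pair P Q) n = (coeff P n, coeff Q n)"
  by (simp add: poly_pair_def coeff_map_poly zero_prod_def)

lemma poly_pair_eq_iff: "poly_pair P Q = poly_pair P' Q' \<longleftrightarrow> P = P' \<and> Q = Q'"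
  by (auto simp: poly_eq_iff coeff_poly_pair)

lemma poly_pair_add: "poly_pair P Q + poly_pair P' Q' = poly_pair (P + P') (Q + Q')"
  by (simp add: poly_eq_iff coeff_poly_pair)

lemma poly_pair_uminus: "- poly_pair P Q = poly_pair (- P) (- Q)"
  by (simp add: poly_eq_iff coeff_poly_pair)

lemma poly_pair_pCons_0: "pCons 0 (poly_pair P Q) = poly_pair (pCons 0 P) (pCons 0 Q)"
  by (auto simp: poly_eq_iff coeff_poly_pair coeff_pCons zero_prod_def split: nat.split)

lemma map_poly_poly_pair:
  assumes "h 0 = 0" "h' 0 = 0"
  shows "map_poly (map_prod h h') (poly_pair P Q) = poly_pair (map_poly h P) (map_poly h' Q)"
  using assms by (simp add: poly_eq_iff coeff_poly_pair coeff_map_poly zero_prod_def)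

lemmas poly_pair_simps = poly_pair_eq_iff poly_pair_add poly_pair_uminus poly_pair_pCons_0

lemma map_poly_additive:
  assumes "h 0 = 0" "\<And>x y. h (x + y) = h x + h y"
  shows "map_poly h (P + Q) = map_poly h P + map_poly h Q"
  using assms by (simp add: poly_eq_iff coeff_map_poly)

lemma pCons_0_add: "pCons 0 (P + Q) = pCons 0 P + pCons 0 Q"
  by simp

lemma module_prod_scale_eq:
  assumes "module s" "module t"
  shows "module_prod.scale s t c = map_prod (s c) (t c)"
proof -
  interpret module_prod s t using assms by (simp add: module_prod_def module_pair_def)
  show ?thesis by (auto simp: scale_def fun_eq_iff)
qed

lemma module_module_prod_scale:
  assumes "module s" "module t" shows "module (module_prod.scale s t)"
proof -
  interpret module_prod s t using assms by (simp add: module_prod_def module_pair_def)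
  show ?thesis by unfold_locales
qed

lemma cscale_prod:
  assumes "module s" "module t"
  shows "cscale (module_prod.scale s t) c = map_prod (cscale s c) (cscale t c)"
  using assms by (simp add: cscale_def module_prod_scale_eq)

lemma deriv_act_prod:
  assumes "module s" "module t"
  shows "deriv_act (module_prod.scale s t) = map_prod (deriv_act s) (deriv_act t)"
  using assms by (simp add: deriv_act_def module_prod_scale_eq)

lemma poly_cscale_poly_pair:
  assumes "module s" "module t"
  shows "poly_cscale (module_prod.scale s t) c (poly_pair P Q) =
    poly_pair (poly_cscale s c P) (poly_cscale t c Q)"
  using assms by (simp add: poly_cscale_def cscale_prod map_poly_poly_pair)

lemma poly_cscale_add:
  "module s \<Longrightarrow> poly_cscale s c (P + Q) = poly_cscale s c P + poly_cscale s c Q"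
  by (simp add: poly_cscale_def map_poly_additive cscale_add)

section \<open>Bilinearity, multiplicativity and sesquilinearity\<close>

lemma clinear_endo_map_prod:
  assumes "module s" "module t" "clinear_endo s f" "clinear_endo t g"
  shows "clinear_endo (module_prod.scale s t) (map_prod f g)"
  using assms module_vector_space_cscale[OF module_module_prod_scale[OF assms(1,2)]]
  by (simp add: clinear_endo_def Vector_Spaces.linear_iff cscale_prod split_paired_all)

lemma clinear_endoD:
  assumes "clinear_endo s f" shows "f 0 = 0" "f (x + y) = f x + f y"
proof -
  show add: "f (x + y) = f x + f y" for x y
    using assms by (simp add: clinear_endo_def Vector_Spaces.linear_iff)
  show "f 0 = 0" using add[of 0 0] by simp
qed

lemma multiplicativeD: "multiplicative h f \<Longrightarrow> map_poly h (f p q) = f (h p) (h q)"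
  by (simp add: multiplicative_def)

lemma multiplicative_total_product:
  assumes "clinear_endo s h" "multiplicative h prec" "multiplicative h succ" "multiplicative h dot"
  shows "multiplicative h (total_product prec succ dot)"
  using assms(2-4) clinear_endoD[OF assms(1)]
  by (simp add: multiplicative_def total_product_def map_poly_additive)

lemma multiplicative_semidirect_product:
  assumes "clinear_endo s h" "clinear_endo t k"
    and "multiplicative h f" "multiplicative k g"
    and "\<And>p m. map_poly k (l p m) = l (h p) (k m)" "\<And>m p. map_poly k (r m p) = r (k m) (h p)"
  shows "multiplicative (map_prod h k) (semidirect_product f g l r)"
  using assms(3-6) clinear_endoD[OF assms(1)] clinear_endoD[OF assms(2)]
  by (simp add: multiplicative_def semidirect_product_def map_poly_poly_pair map_poly_additive
      split_paired_all)

lemma lambda_bilinear_total_product: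
  assumes "module s" "lambda_bilinear s s s prec" "lambda_bilinear s s s succ"
    "lambda_bilinear s s s dot"
  shows "lambda_bilinear s s s (total_product prec succ dot)"
  using assms(2-4)
  by (simp add: lambda_bilinear_iff assms(1) total_product_def poly_cscale_add add_ac)

lemma conformal_sesquilinear_total_product:
  assumes "module s" "conformal_sesquilinear s s s prec" "conformal_sesquilinear s s s succ"
    "conformal_sesquilinear s s s dot"
  shows "conformal_sesquilinear s s s (total_product prec succ dot)"
  using assms(2-4) lambda_bilinear_total_product[OF assms(1), of prec succ dot]
  unfolding conformal_sesquilinear_def
  \<comment> \<open>\<open>add_pCons\<close> rewrites in the opposite direction to \<open>pCons_0_add\<close>\<close>
  by (simp add: total_product_def map_poly_additive assms(1) deriv_act_add pCons_0_add
      del: minus_pCons add_pCons)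

lemma lambda_bilinear_semidirect_product:
  assumes "module s" "module t"
    and "lambda_bilinear s s s f" "lambda_bilinear t t t g"
    and "lambda_bilinear s t t l" "lambda_bilinear t s t r"
  shows "lambda_bilinear (module_prod.scale s t) (module_prod.scale s t) (module_prod.scale s t)
    (semidirect_product f g l r)"
  using assms(3-6)
  by (simp add: lambda_bilinear_iff module_module_prod_scale assms(1,2) split_paired_all
      semidirect_product_def cscale_prod poly_cscale_poly_pair poly_cscale_add poly_pair_simps
      add_ac)

text \<open>The module component of the semidirect product is a sum of three products, but it can be
  tested on arguments that each lie in one of the two summands: then at most one of the three
  products is nonzero.\<close>

lemma conformal_sesquilinear_semidirect_product_iff:
  assumes s: "module s" and t: "module t"
    and f: "lambda_bilinear s s s f" and g: "lambda_bilinear t t t g"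
    and l: "lambda_bilinear s t t l" and r: "lambda_bilinear t s t r"
  shows "conformal_sesquilinear (module_prod.scale s t) (module_prod.scale s t)
      (module_prod.scale s t) (semidirect_product f g l r) \<longleftrightarrow>
    conformal_sesquilinear s s s f \<and> conformal_sesquilinear t t t g \<and>
    conformal_sesquilinear s t t l \<and> conformal_sesquilinear t s t r"
    (is "?S \<longleftrightarrow> ?C")
proof -
  note zero = biadditiveD(3,4)[OF lambda_bilinear_biadditive]
  have S: "?S \<longleftrightarrow>
    (\<forall>p m q n. f (deriv_act s p) q = - pCons 0 (f p q) \<and>
       l (deriv_act s p) n + r (deriv_act t m) q + g (deriv_act t m) n =
         - pCons 0 (l p n + r m q + g m n)) \<and>
    (\<forall>p m q n. f p (deriv_act s q) = map_poly (deriv_act s) (f p q) + pCons 0 (f p q) \<and>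
       l p (deriv_act t n) + r m (deriv_act s q) + g m (deriv_act t n) =
         map_poly (deriv_act t) (l p n + r m q + g m n) + pCons 0 (l p n + r m q + g m n))"
    unfolding conformal_sesquilinear_def
    using lambda_bilinear_semidirect_product[OF assms]
    by (simp add: split_paired_all semidirect_product_def deriv_act_prod s t
        map_poly_poly_pair poly_pair_simps)
  show ?thesis
  proof
    assume ?S
    then have left: "f (deriv_act s p) q = - pCons 0 (f p q)"
        "l (deriv_act s p) n + r (deriv_act t m) q + g (deriv_act t m) n =
         - pCons 0 (l p n + r m q + g m n)"
      and right: "f p (deriv_act s q) = map_poly (deriv_act s) (f p q) + pCons 0 (f p q)"
       "l p (deriv_act t n) + r m (deriv_act s q) + g m (deriv_act t n) =
         map_poly (deriv_act t) (l p n + r m q + g m n) + pCons 0 (l p n + r m q + g m n)"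
      for p m q n unfolding S by blast+
    show ?C
      unfolding conformal_sesquilinear_def
      using f g l r left(1) right(1)
        left(2)[where m=0 and q=0] left(2)[where p=0 and n=0] left(2)[where p=0 and q=0]
        right(2)[where m=0 and q=0] right(2)[where p=0 and n=0] right(2)[where p=0 and q=0]
      by (simp add: zero[OF f] zero[OF g] zero[OF l] zero[OF r] s t)
  next
    assume ?C
    then show ?S
      unfolding S unfolding conformal_sesquilinear_def
      by (simp add: map_poly_additive t deriv_act_add pCons_0_add
          del: minus_pCons add_pCons)
  qed
qed

section \<open>Associativity of the semidirect product\<close>

lemma biadditive_semidirect_product:
  assumes "biadditive f" "biadditive g" "biadditive l" "biadditive r"
  shows "biadditive (semidirect_product f g l r)"
  using assms
  by (simp add: biadditive_def semidirect_product_def split_paired_all poly_pair_simps add_ac)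

text \<open>In the module component, one summand for each of the seven ways to take the three arguments
  from algebra and module with at least one from the module. The expansion is stated for
  coefficients, where pairs are literal.\<close>

lemma nest_right_semidirect_product:
  fixes f g l r :: "('a::ab_group_add, 'a, 'a) lambda_product"
  assumes f: "biadditive f" and g: "biadditive g" and l: "biadditive l" and r: "biadditive r"
  shows "coeff (coeff (nest_right (semidirect_product f g l r) (semidirect_product f g l r)
      (p, m) (q, n) (x, k)) i) j =
    (coeff (coeff (nest_right f f p q x) i) j,
     coeff (coeff (nest_right l l p q k + nest_right l r p n x + nest_right l g p n k +
       nest_right r f m q x +
       nest_right g l m q k + nest_right g r m n x + nest_right g g m n k) i) j)"
  using assms
  by (simp add: coeff_nest_right biadditive_semidirect_product)
     (simp add: semidirect_product_def coeff_poly_pair add_ac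
       biadditiveD[OF f] biadditiveD[OF g] biadditiveD[OF l] biadditiveD[OF r])

lemma nest_left_semidirect_product:
  fixes f g l r :: "('a::ab_group_add, 'a, 'a) lambda_product"
  assumes s: "module s" and f: "biadditive f" and g: "biadditive g" and l: "biadditive l"
    and r: "biadditive r"
  shows "coeff (coeff (nest_left (module_prod.scale s s)
      (semidirect_product f g l r) (semidirect_product f g l r) (p, m) (q, n) (x, k)) i) j =
    (coeff (coeff (nest_left s f f p q x) i) j,
     coeff (coeff (nest_left s f l p q k + nest_left s l r p n x + nest_left s l g p n k +
       nest_left s r r m q x +
       nest_left s r g m q k + nest_left s g r m n x + nest_left s g g m n k) i) j)"
  using assms
  by (simp add: coeff_nest_left biadditive_semidirect_product module_module_prod_scale)
     (simp add: semidirect_product_def coeff_poly_pair add_ac cscale_prod sum_prod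
       cscale_add[OF s] sum.distrib
       biadditiveD[OF f] biadditiveD[OF g] biadditiveD[OF l] biadditiveD[OF r])

text \<open>Each condition on the right is the restriction of associativity to arguments in fixed summands:
  all in the algebra for the first one, then in the order of the summands above.\<close>

lemma semidirect_product_associative_iff:
  fixes f g l r :: "('a::ab_group_add, 'a, 'a) lambda_product"
  assumes s: "module s" and f: "biadditive f" and g: "biadditive g"
    and l: "biadditive l" and r: "biadditive r"
    and "\<alpha> 0 = 0" "\<beta> 0 = 0"
  defines "F \<equiv> semidirect_product f g l r"
  shows "(\<forall>u v w. nest_right F F (map_prod \<alpha> \<alpha> u) v w =
      nest_left (module_prod.scale s s) F F u v (map_prod \<beta> \<beta> w)) \<longleftrightarrow>
    (\<forall>p q x.
      nest_right f f (\<alpha> p) q x = nest_left s f f p q (\<beta> x) \<and>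
      nest_right l l (\<alpha> p) q x = nest_left s f l p q (\<beta> x) \<and>
      nest_right l r (\<alpha> p) q x = nest_left s l r p q (\<beta> x) \<and>
      nest_right l g (\<alpha> p) q x = nest_left s l g p q (\<beta> x) \<and>
      nest_right r f (\<alpha> p) q x = nest_left s r r p q (\<beta> x) \<and>
      nest_right g l (\<alpha> p) q x = nest_left s r g p q (\<beta> x) \<and>
      nest_right g r (\<alpha> p) q x = nest_left s g r p q (\<beta> x) \<and>
      nest_right g g (\<alpha> p) q x = nest_left s g g p q (\<beta> x))"
    (is "?S \<longleftrightarrow> ?C")
proof -
  have pair: "nest_right F F (map_prod \<alpha> \<alpha> (p, m)) (q, n) (x, k) =
      nest_left (module_prod.scale s s) F F (p, m) (q, n) (map_prod \<beta> \<beta> (x, k)) \<longleftrightarrow>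
    nest_right f f (\<alpha> p) q x = nest_left s f f p q (\<beta> x) \<and>
    nest_right l l (\<alpha> p) q k + nest_right l r (\<alpha> p) n x + nest_right l g (\<alpha> p) n k +
      nest_right r f (\<alpha> m) q x + nest_right g l (\<alpha> m) q k + nest_right g r (\<alpha> m) n x +
      nest_right g g (\<alpha> m) n k =
    nest_left s f l p q (\<beta> k) + nest_left s l r p n (\<beta> x) + nest_left s l g p n (\<beta> k) +
      nest_left s r r m q (\<beta> x) + nest_left s r g m q (\<beta> k) + nest_left s g r m n (\<beta> x) +
      nest_left s g g m n (\<beta> k)"
    for p m q n x k
    by (auto simp: F_def poly_eq_iff nest_right_semidirect_product[OF f g l r]
        nest_left_semidirect_product[OF s f g l r])
  have R0: "nest_right a b 0 y z = 0" "nest_right a b y 0 z = 0" "nest_right a b y z 0 = 0"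
    if "biadditive a" "biadditive b"
    for a b :: "('a, 'a, 'a) lambda_product" and y z
    by (simp_all add: poly_eq_iff coeff_nest_right[OF that(1)] biadditiveD[OF that(1)]
        biadditiveD[OF that(2)])
  have L0: "nest_left s a b 0 y z = 0" "nest_left s a b y 0 z = 0" "nest_left s a b y z 0 = 0"
    if "biadditive a" "biadditive b"
    for a b :: "('a, 'a, 'a) lambda_product" and y z
    by (simp_all add: poly_eq_iff coeff_nest_left[OF s that(2)] biadditiveD[OF that(1)]
        biadditiveD[OF that(2)] s)
  show ?thesis
  proof
    assume ?S
    then have S: "nest_right F F (map_prod \<alpha> \<alpha> (p, m)) (q, n) (x, k) =
      nest_left (module_prod.scale s s) F F (p, m) (q, n) (map_prod \<beta> \<beta> (x, k))" for p m q n x k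
      by blast
    show ?C
    proof (intro allI)
      fix p q x
      show "nest_right f f (\<alpha> p) q x = nest_left s f f p q (\<beta> x) \<and>
        nest_right l l (\<alpha> p) q x = nest_left s f l p q (\<beta> x) \<and>
        nest_right l r (\<alpha> p) q x = nest_left s l r p q (\<beta> x) \<and>
        nest_right l g (\<alpha> p) q x = nest_left s l g p q (\<beta> x) \<and>
        nest_right r f (\<alpha> p) q x = nest_left s r r p q (\<beta> x) \<and>
        nest_right g l (\<alpha> p) q x = nest_left s r g p q (\<beta> x) \<and>
        nest_right g r (\<alpha> p) q x = nest_left s g r p q (\<beta> x) \<and>
        nest_right g g (\<alpha> p) q x = nest_left s g g p q (\<beta> x)"
        \<comment> \<open>one instance for each choice of summands, with zero in the other components\<close>
        using S[of p 0 q 0 x 0, unfolded pair] S[of p 0 q 0 0 x, unfolded pair]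
          S[of p 0 0 q x 0, unfolded pair] S[of p 0 0 q 0 x, unfolded pair]
          S[of 0 p q 0 x 0, unfolded pair] S[of 0 p q 0 0 x, unfolded pair]
          S[of 0 p 0 q x 0, unfolded pair] S[of 0 p 0 q 0 x, unfolded pair]
        by (simp add: R0 L0 f g l r assms(6,7))
    qed
  next
    assume ?C
    then show ?S by (simp only: split_paired_All pair) simp
  qed
qed

theorem proposition2p18:
  fixes s :: "complex poly \<Rightarrow> 'a::ab_group_add \<Rightarrow> 'a"
    and prec succ dot :: "('a, 'a, 'a) lambda_product"
    and \<alpha> \<beta> :: "'a \<Rightarrow> 'a"
  assumes "module s"
    and "lambda_bilinear s s s prec"
    and "lambda_bilinear s s s succ"
    and "lambda_bilinear s s s dot"
    and "clinear_endo s \<alpha>" and "clinear_endo s \<beta>" and "\<alpha> \<circ> \<beta> = \<beta> \<circ> \<alpha>"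
    and "multiplicative \<alpha> prec" and "multiplicative \<alpha> succ" and "multiplicative \<alpha> dot"
    and "multiplicative \<beta> prec" and "multiplicative \<beta> succ" and "multiplicative \<beta> dot"
  shows "bihom_tridendriform_conformal_algebra s prec succ dot \<alpha> \<beta> \<longleftrightarrow>
    bihom_assoc_conformal_algebra s (total_product prec succ dot) \<alpha> \<beta> \<and>
    conformal_bimodule_algebra s (total_product prec succ dot) \<alpha> \<beta>
      s dot (\<lambda>p m. succ p m) (\<lambda>m p. prec m p) \<alpha> \<beta>"
proof -
  let ?T = "total_product prec succ dot"
  let ?F = "semidirect_product ?T dot succ prec"
  let ?s2 = "module_prod.scale s s"
  let ?d = "deriv_act s"
  note s = assms(1) and bil = assms(2-4) and lin = assms(5,6)
  note biadd = bil[THEN lambda_bilinear_biadditive]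
  have bilT: "lambda_bilinear s s s ?T"
    using s bil by (rule lambda_bilinear_total_product)
  have biaddT: "biadditive ?T" using bilT by (rule lambda_bilinear_biadditive)
  let ?sesq = "conformal_sesquilinear s s s"
  let ?deriv = "\<alpha> \<circ> ?d = ?d \<circ> \<alpha> \<and> \<beta> \<circ> ?d = ?d \<circ> \<beta>"
  let ?assoc = "\<lambda>f g f' g'. \<forall>p q r. nest_right f g (\<alpha> p) q r = nest_left s f' g' p q (\<beta> r)"
  let ?axioms = "?assoc prec ?T prec prec \<and> ?assoc succ prec succ prec \<and>
    ?assoc succ succ ?T succ \<and> ?assoc dot succ prec dot \<and> ?assoc succ dot succ dot \<and>
    ?assoc dot prec dot prec \<and> ?assoc dot dot dot dot"
  have trid: "bihom_tridendriform_conformal_algebra s prec succ dot \<alpha> \<beta> \<longleftrightarrow>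
    ?sesq prec \<and> ?sesq succ \<and> ?sesq dot \<and> ?deriv \<and> ?axioms"
    unfolding bihom_tridendriform_conformal_algebra_def using assms by metis
  have multT: "multiplicative \<alpha> ?T" "multiplicative \<beta> ?T"
    using assms by (auto intro: multiplicative_total_product)
  have total: "bihom_assoc_conformal_algebra s ?T \<alpha> \<beta> \<longleftrightarrow>
    ?sesq ?T \<and> ?deriv \<and> ?assoc ?T ?T ?T ?T"
    unfolding bihom_assoc_conformal_algebra_def using assms multT by blast
  have multF: "multiplicative (map_prod \<alpha> \<alpha>) ?F" "multiplicative (map_prod \<beta> \<beta>) ?F"
    using multiplicative_semidirect_product[where l = succ and r = prec,
        OF lin(1) lin(1) multT(1) assms(10)
        multiplicativeD[OF assms(9)] multiplicativeD[OF assms(8)]]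
      multiplicative_semidirect_product[where l = succ and r = prec,
        OF lin(2) lin(2) multT(2) assms(13)
        multiplicativeD[OF assms(12)] multiplicativeD[OF assms(11)]] .
  have linF: "clinear_endo ?s2 (map_prod \<alpha> \<alpha>)" "clinear_endo ?s2 (map_prod \<beta> \<beta>)"
    using s lin by (auto intro: clinear_endo_map_prod)
  have commF: "map_prod \<alpha> \<alpha> \<circ> map_prod \<beta> \<beta> = map_prod \<beta> \<beta> \<circ> map_prod \<alpha> \<alpha>"
    using assms(7) by (simp add: map_prod.comp)
  have derivF: "map_prod h h \<circ> deriv_act ?s2 = deriv_act ?s2 \<circ> map_prod h h \<longleftrightarrow>
      h \<circ> ?d = ?d \<circ> h" for h :: "'a \<Rightarrow> 'a"
    by (auto simp: deriv_act_prod s fun_eq_iff)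
  have semi: "bihom_assoc_conformal_algebra ?s2 ?F (map_prod \<alpha> \<alpha>) (map_prod \<beta> \<beta>) \<longleftrightarrow>
    (?sesq ?T \<and> ?sesq dot \<and> ?sesq succ \<and> ?sesq prec) \<and> ?deriv \<and> ?assoc ?T ?T ?T ?T \<and> ?axioms"
    unfolding bihom_assoc_conformal_algebra_def derivF
      conformal_sesquilinear_semidirect_product_iff[OF s s bilT bil(3,2,1)]
      semidirect_product_associative_iff[where \<alpha> = \<alpha> and \<beta> = \<beta>,
        OF s biaddT biadd(3,2,1)
        lin(1)[THEN clinear_endoD(1)] lin(2)[THEN clinear_endoD(1)]] all_conj_distrib
    using module_module_prod_scale[OF s s] multF linF commF by argo
  have bimod: "conformal_bimodule_algebra s ?T \<alpha> \<beta> s dot succ prec \<alpha> \<beta> \<longleftrightarrow>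
    bihom_assoc_conformal_algebra s ?T \<alpha> \<beta> \<and>
    bihom_assoc_conformal_algebra ?s2 ?F (map_prod \<alpha> \<alpha>) (map_prod \<beta> \<beta>)"
    unfolding conformal_bimodule_algebra_def using assms(1-7) by simp
  \<comment> \<open>the sum of the seven axioms; \<open>prec\<close> outside \<open>?T\<close> on the right and \<open>succ\<close> outside \<open>?T\<close> on
    the left stay unexpanded, because the axioms contain them in this form\<close>
  have "?assoc ?T ?T ?T ?T" if ?axioms
    using that
    by (simp add: nest_right_total_product_outer[OF biadd]
        nest_left_total_product_outer[OF s biadd]
        nest_right_total_product_inner[OF biadd(2)] nest_right_total_product_inner[OF biadd(3)]
        nest_left_total_product_inner[OF s biadd(1)] nest_left_total_product_inner[OF s biadd(3)]
        add_ac)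
  moreover have "?sesq ?T" if "?sesq prec" "?sesq succ" "?sesq dot"
    using s that by (rule conformal_sesquilinear_total_product)
  ultimately show ?thesis
    unfolding trid total bimod semi by argo
qed

end
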